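(* Suppose that $\mathbb{E}\|Z\| < \infty$ and that $\mu := \mathbb{E} Z \neq \mathbf{0}$. Then \[ \lim_{n\to\infty} \frac{L_n}{D_n} = 2, \quad \text{almost surely}. \]
   Context: Let $Z, Z_1, Z_2, \ldots$ be i.i.d. random variables in $\mathbb{R}^2$, and let $S_0 := \mathbf{0}$ (the origin) and $S_n := \sum_{k=1}^n Z_k$ for $n \ge 1$. Let $\mathcal{H}_n$ be the convex hull of $\{S_0, \ldots, S_n\}$, let $L_n$ be the perimeter length of $\mathcal{H}_n$, and let $D_n := \operatorname{diam}\mathcal{H}_n = \max_{0\le i,j\le n}\|S_j-S_i\|$. (If $\mathcal{H}_n$ is a line segment, its perimeter length is twice the length of the segment; in general, $L_n = \int_0^{2\pi} \max_{0\le k\le n} (S_k\cdot \mathbf{e}_\theta)\,d\theta$ with $\mathbf{e}_\theta = (\cos\theta,\sin\theta)$.) Here $\|\cdot\|$ is the Euclidean norm. Since $\mathbb{P}(Z = \mathbf{0}) < 1$, $D_n > 0$ for all but finitely many $n$, a.s., so the ratio is eventually well defined. *)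

theory Defs
  imports "HOL-Probability.Probability"
begin

definition walk :: "(nat \<Rightarrow> 'a \<Rightarrow> real^2) \<Rightarrow> nat \<Rightarrow> 'a \<Rightarrow> real^2" where
  "walk X n \<omega> = (\<Sum>k=1..n. X k \<omega>)"

definition walk_hull :: "(nat \<Rightarrow> 'a \<Rightarrow> real^2) \<Rightarrow> nat \<Rightarrow> 'a \<Rightarrow> (real^2) set" where
  "walk_hull X n \<omega> = convex hull ((\<lambda>k. walk X k \<omega>) ` {0..n})"

(* Perimeter length of a planar convex polygon, i.e. of a polytope in the plane.  A
   two-dimensional polygon has finitely many edges, each a segment whose length is its diameter.
   The second branch is the convention for degenerate polygons: a segment counts twice its
   length, and a point has perimeter 0.  Not meaningful for sets that are not polytopes. *)
definition polygon_perimeter :: "(real^2) set \<Rightarrow> real" where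
  "polygon_perimeter P =
     (if aff_dim P = 2 then (\<Sum>e | e edge_of P. diameter e) else 2 * diameter P)"

end

theory Submission
  imports Defs
begin

text \<open>
  The walk drifts in the direction \<open>u\<close> of the mean: by the strong law of large numbers its
  displacement along \<open>u\<close> grows like \<open>n * norm \<mu>\<close>, whereas its displacement orthogonal to \<open>u\<close> is
  \<open>o(n)\<close>. So the hull is a sliver, long in one direction and thin in the other, and the boundary of
  a sliver runs essentially once forth and once back along a diameter.

  Two ingredients make this precise.

  The first is the identity behind Cauchy's perimeter formula, for a single direction
  (\<open>sum_edges_projection\<close>): the projections of the edges of a convex polygon to a line have total
  length twice the length of the projection of the polygon, because a generic line orthogonal to the
  projection line that meets the interior crosses exactly two edges. Projecting along a diameter gives
  perimeter \<open>\<ge> 2 * diameter\<close>. Bounding each edge by the sum of its projections to two orthogonal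
  directions gives perimeter \<open>\<le> 2 * diameter + 2 * width\<close>, where the width is orthogonal to \<open>u\<close>.
  Divided by the diameter, which is at least of order \<open>n\<close>, the width disappears in the limit. This
  deterministic part is \<open>perimeter_over_diameter_tendsto\<close>.

  The second is the strong law under a first moment alone, needed for the two real walks obtained by
  taking inner products with \<open>u\<close> and with its rotation by a right angle. It follows from the
  fact that a random walk with integrable steps of negative mean is almost surely bounded above, which
  is proved by an argument in the style of the maximal ergodic theorem: if \<open>M n\<close> is the maximum of the
  first partial sums \<open>S 0, ..., S n\<close> and \<open>M' n\<close> the same for the walk without its first step \<open>x\<close>,
  then \<open>M (n + 1) - M' n = max (- M' n) x\<close>. This has nonnegative mean because \<open>M' n\<close> has the
  law of \<open>M n\<close>, which is at most \<open>M (n + 1)\<close>, even after restricting to the event that \<open>M\<close> is unbounded, an event that does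
  not depend on the first step; on that event the difference tends to \<open>x\<close>. Hence the mean of \<open>x\<close>
  times the probability of the event is nonnegative, and the event must be null.
\<close>

section \<open>Partial sums of a sequence and their running maximum\<close>

text \<open>
  The maximum of the partial sums of lengths \<open>0, ..., n\<close>. Recursion on the first term rather than the
  last gives the identity relating a walk and the walk without its first step directly.
\<close>
primrec max_sum :: "nat \<Rightarrow> (nat \<Rightarrow> real) \<Rightarrow> real" where
  "max_sum 0 \<omega> = 0"
| "max_sum (Suc n) \<omega> = max 0 (\<omega> 0 + max_sum n (\<lambda>i. \<omega> (Suc i)))"

lemma max_sum_nonneg: "0 \<le> max_sum n \<omega>"
  by (cases n) auto

lemma max_sum_le_Suc: "max_sum n \<omega> \<le> max_sum (Suc n) \<omega>"
proof (induction n arbitrary: \<omega>)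
  case (Suc n)
  have "max_sum n (\<lambda>i. \<omega> (Suc i)) \<le> max_sum (Suc n) (\<lambda>i. \<omega> (Suc i))"
    by (rule Suc.IH)
  then show ?case
    unfolding max_sum.simps(2)[of _ \<omega>] by (intro max.mono add_left_mono order_refl)
qed simp

lemma incseq_max_sum: "incseq (\<lambda>n. max_sum n \<omega>)"
  by (intro incseq_SucI max_sum_le_Suc)

lemma sum_le_max_sum: "(\<Sum>k<n. \<omega> k) \<le> max_sum n \<omega>"
proof (induction n arbitrary: \<omega>)
  case (Suc n)
  have "(\<Sum>k<Suc n. \<omega> k) = \<omega> 0 + (\<Sum>k<n. \<omega> (Suc k))"
    by (rule sum.lessThan_Suc_shift)
  also have "\<dots> \<le> \<omega> 0 + max_sum n (\<lambda>i. \<omega> (Suc i))"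
    using Suc.IH by simp
  also have "\<dots> \<le> max_sum (Suc n) \<omega>" by simp
  finally show ?case .
qed simp

definition unbounded_sums :: "(nat \<Rightarrow> real) set" where
  "unbounded_sums = {\<omega>. \<not> bdd_above (range (\<lambda>n. max_sum n \<omega>))}"

text \<open>
  A new first step shifts all other partial sums by the same constant. So the event of unboundedness
  is determined by all steps but the first, and this replaces the zero-one law.
\<close>
lemma unbounded_sums_Cons: "case_nat x \<omega> \<in> unbounded_sums \<longleftrightarrow> \<omega> \<in> unbounded_sums"
proof -
  have "bdd_above (range (\<lambda>n. max_sum n (case_nat x \<omega>))) \<longleftrightarrow> bdd_above (range (\<lambda>n. max_sum n \<omega>))"
  proof
    assume "bdd_above (range (\<lambda>n. max_sum n (case_nat x \<omega>)))"
    then obtain B where B: "max_sum n (case_nat x \<omega>) \<le> B" for n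
      by (auto simp: bdd_above_def)
    have "max_sum n \<omega> \<le> B - x" for n
      using B[of "Suc n"] by simp
    then show "bdd_above (range (\<lambda>n. max_sum n \<omega>))" by (intro bdd_aboveI) auto
  next
    assume "bdd_above (range (\<lambda>n. max_sum n \<omega>))"
    then obtain B where B: "max_sum n \<omega> \<le> B" for n
      by (auto simp: bdd_above_def)
    have "max_sum n (case_nat x \<omega>) \<le> max 0 (x + B)" for n
    proof (cases n)
      case (Suc m)
      then show ?thesis using B[of m] by (auto simp: max_def)
    qed simp
    then show "bdd_above (range (\<lambda>n. max_sum n (case_nat x \<omega>)))" by (intro bdd_aboveI) auto
  qed
  then show ?thesis by (simp add: unbounded_sums_def)
qed

section \<open>Random walks with negative mean are bounded above\<close>

text \<open>
  Sequences of independent samples from a law \<open>D\<close>, realised canonically on the infinite product \<open>S\<close>.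
\<close>
locale real_iid = sequence_space D for D :: "real measure" +
  assumes sets_D [measurable_cong, simp]: "sets D = sets borel"
    and integrable_D: "integrable D (\<lambda>x. x)"
begin

lemma space_D [simp]: "space D = UNIV"
  using sets_eq_imp_space_eq[OF sets_D] by simp

lemma measurable_shift: "(\<lambda>\<omega> i. \<omega> (Suc i)) \<in> measurable S S"
  by (rule measurable_PiM_single', rule measurable_component_singleton) (auto simp: space_PiM)

lemma borel_measurable_max_sum [measurable]: "max_sum n \<in> borel_measurable S"
proof (induction n)
  case (Suc n)
  have "(\<lambda>\<omega>. max_sum n (\<lambda>i. \<omega> (Suc i))) \<in> borel_measurable S"
    using measurable_shift Suc.IH by (rule measurable_compose)
  moreover have "(\<lambda>\<omega>. \<omega> 0) \<in> borel_measurable S"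
    using measurable_component_singleton[of 0 UNIV "\<lambda>_. D"] by (simp cong: measurable_cong_sets)
  ultimately show ?case by simp
next
  case 0
  show ?case by (simp add: max_sum.simps(1)[abs_def])
qed

lemma sets_unbounded_sums [measurable]: "unbounded_sums \<in> sets S"
proof -
  have "unbounded_sums = {\<omega>\<in>space S. \<forall>B::nat. \<exists>n. max_sum n \<omega> > real B}"
  proof (intro set_eqI iffI)
    fix \<omega> assume "\<omega> \<in> unbounded_sums"
    then show "\<omega> \<in> {\<omega>\<in>space S. \<forall>B::nat. \<exists>n. max_sum n \<omega> > real B}"
      by (auto simp: unbounded_sums_def bdd_above_def space_PiM PiE_def not_le)
  next
    fix \<omega> assume *: "\<omega> \<in> {\<omega>\<in>space S. \<forall>B::nat. \<exists>n. max_sum n \<omega> > real B}"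
    show "\<omega> \<in> unbounded_sums"
      unfolding unbounded_sums_def
    proof (safe)
      assume "bdd_above (range (\<lambda>n. max_sum n \<omega>))"
      then obtain B where B: "max_sum n \<omega> \<le> B" for n by (auto simp: bdd_above_def)
      obtain k :: nat where "B < real k" using reals_Archimedean2 by blast
      with * B show False by (auto dest!: spec[of _ k]) (meson B less_le_trans not_less order_less_imp_le)
    qed
  qed
  also have "\<dots> \<in> sets S" by measurable
  finally show ?thesis .
qed

lemma measurable_Cons: "(\<lambda>(x, \<omega>). case_nat x \<omega>) \<in> measurable (D \<Otimes>\<^sub>M S) S"
  by measurable

interpretation DS: pair_prob_space D S ..

text \<open>
  Putting an independent sample in front of a sequence does not change its law. This is the
  stationarity that the argument uses.
\<close>
lemma integral_Cons:
  fixes f :: "(nat \<Rightarrow> real) \<Rightarrow> real"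
  assumes [measurable]: "f \<in> borel_measurable S"
  shows "(\<integral>p. f (case p of (x, \<omega>) \<Rightarrow> case_nat x \<omega>) \<partial>(D \<Otimes>\<^sub>M S)) = (\<integral>\<omega>. f \<omega> \<partial>S)"
    and "integrable (D \<Otimes>\<^sub>M S) (\<lambda>p. f (case p of (x, \<omega>) \<Rightarrow> case_nat x \<omega>)) \<longleftrightarrow> integrable S f"
  using integral_distr[OF measurable_Cons assms] integrable_distr_eq[OF measurable_Cons assms]
  by (simp_all add: PiM_iter)

lemma distr_fst: "distr (D \<Otimes>\<^sub>M S) D fst = D"
  by (rule P.distr_pair_fst)

lemma distr_snd: "distr (D \<Otimes>\<^sub>M S) S snd = S"
proof -
  interpret SD: pair_prob_space S D ..
  have "distr (D \<Otimes>\<^sub>M S) S snd = distr (distr (S \<Otimes>\<^sub>M D) (D \<Otimes>\<^sub>M S) (\<lambda>(x, y). (y, x))) S snd"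
    using DS.distr_pair_swap by simp
  also have "\<dots> = distr (S \<Otimes>\<^sub>M D) S fst"
    by (subst distr_distr) (auto simp: comp_def case_prod_beta')
  also have "\<dots> = S" by (rule M.distr_pair_fst)
  finally show ?thesis .
qed

lemma integrable_fst_D: "integrable (D \<Otimes>\<^sub>M S) (\<lambda>p. fst p)"
  using integrable_distr[of fst "D \<Otimes>\<^sub>M S" D "\<lambda>x. x"] integrable_D by (simp add: distr_fst)

lemma integrable_max_sum: "integrable S (max_sum n)"
proof (induction n)
  case (Suc n)
  have "integrable (D \<Otimes>\<^sub>M S) (\<lambda>p. max_sum n (snd p))"
    using integrable_distr[of snd "D \<Otimes>\<^sub>M S" S "max_sum n"] Suc by (simp add: distr_snd)
  then have "integrable (D \<Otimes>\<^sub>M S) (\<lambda>p. max 0 (fst p + max_sum n (snd p)))"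
    by (intro integrable_max integrable_fst_D Bochner_Integration.integrable_add) auto
  then show ?case
    by (subst integral_Cons(2)[symmetric]) (auto simp: case_prod_beta')
qed (simp add: max_sum.simps(1)[abs_def])

lemma integral_snd_S:
  assumes [measurable]: "(f :: _ \<Rightarrow> real) \<in> borel_measurable S"
  shows "(\<integral>p. f (snd p) \<partial>(D \<Otimes>\<^sub>M S)) = (\<integral>\<omega>. f \<omega> \<partial>S)"
    and "integrable (D \<Otimes>\<^sub>M S) (\<lambda>p. f (snd p)) \<longleftrightarrow> integrable S f"
  using integral_distr[of snd "D \<Otimes>\<^sub>M S" S f] integrable_distr_eq[of snd "D \<Otimes>\<^sub>M S" S f]
  by (simp_all add: distr_snd)

text \<open>
  The integrand is the difference of the two maxima, of \<open>n + 1\<close> steps and of \<open>n\<close> steps without the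
  first, on the event of unboundedness. By stationarity the second maximum may be
  replaced by the maximum of the first \<open>n\<close> steps of the same walk, which is the smaller one.
\<close>
lemma integral_increment_nonneg:
  "0 \<le> (\<integral>p. max (- max_sum n (snd p)) (fst p) * indicator unbounded_sums (snd p) \<partial>(D \<Otimes>\<^sub>M S))"
proof -
  let ?A = "unbounded_sums"
  define g where "g n = (\<lambda>\<omega>. max_sum n \<omega> * indicator ?A \<omega>)" for n
  have g_meas [measurable]: "g n \<in> borel_measurable S" for n
    unfolding g_def by measurable
  have g_int: "integrable S (g n)" for n
    unfolding g_def using integrable_max_sum by (intro integrable_real_mult_indicator) auto
  have "(\<integral>\<omega>. g n \<omega> \<partial>S) \<le> (\<integral>\<omega>. g (Suc n) \<omega> \<partial>S)"
    by (intro integral_mono g_int) (auto simp: g_def max_sum_le_Suc indicator_def simp del: max_sum.simps)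
  also have "\<dots> = (\<integral>p. g (Suc n) (case p of (x, \<omega>) \<Rightarrow> case_nat x \<omega>) \<partial>(D \<Otimes>\<^sub>M S))"
    by (rule integral_Cons(1)[symmetric]) measurable
  finally have "0 \<le> (\<integral>p. g (Suc n) (case p of (x, \<omega>) \<Rightarrow> case_nat x \<omega>) \<partial>(D \<Otimes>\<^sub>M S))
      - (\<integral>p. g n (snd p) \<partial>(D \<Otimes>\<^sub>M S))"
    by (simp add: integral_snd_S)
  also have "\<dots> = (\<integral>p. g (Suc n) (case p of (x, \<omega>) \<Rightarrow> case_nat x \<omega>) - g n (snd p) \<partial>(D \<Otimes>\<^sub>M S))"
    by (intro Bochner_Integration.integral_diff[symmetric])
       (simp_all add: integral_snd_S integral_Cons g_int)
  also have "\<dots> = (\<integral>p. max (- max_sum n (snd p)) (fst p) * indicator ?A (snd p) \<partial>(D \<Otimes>\<^sub>M S))"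
    by (intro Bochner_Integration.integral_cong refl)
       (auto simp: g_def unbounded_sums_Cons indicator_def split: prod.split)
  finally show ?thesis .
qed

text \<open>
  As \<open>n\<close> grows, the increments \<open>max (- max_sum n \<omega>) x\<close> converge to \<open>x\<close> wherever the maximum is
  unbounded, and \<open>\<bar>x\<bar>\<close> dominates them. The limit of the nonnegative integrals factorises, since the
  first step is independent of the event.
\<close>
theorem AE_bounded_sums:
  assumes "(\<integral>x. x \<partial>D) < 0"
  shows "AE \<omega> in S. \<exists>B. \<forall>n. (\<Sum>k<n. \<omega> k) \<le> B"
proof -
  let ?A = "unbounded_sums"
  let ?f = "\<lambda>n p. max (- max_sum n (snd p)) (fst p) * indicator ?A (snd p) :: real"
  have lim: "(\<lambda>n. ?f n p) \<longlonglongrightarrow> fst p * indicator ?A (snd p)" for p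
  proof (cases "snd p \<in> ?A")
    case True
    then have "\<not> (\<forall>n. max_sum n (snd p) \<le> - fst p)"
      unfolding unbounded_sums_def by (auto intro: bdd_aboveI)
    then obtain N where N: "- fst p < max_sum N (snd p)"
      by (auto simp: not_le)
    have "\<forall>\<^sub>F n in sequentially. ?f n p = fst p * indicator ?A (snd p)"
      using eventually_ge_at_top[of N]
    proof eventually_elim
      case (elim n)
      then have "max_sum N (snd p) \<le> max_sum n (snd p)"
        by (intro incseqD[OF incseq_max_sum])
      with N have "- max_sum n (snd p) \<le> fst p" by simp
      then show ?case by (simp add: max_absorb2)
    qed
    then show ?thesis by (rule tendsto_eventually)
  qed simp
  have bound: "norm (?f n p) \<le> norm (fst p)" for n p
    using max_sum_nonneg[of n "snd p"] by (auto simp: indicator_def max_def)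
  have "(\<lambda>n. \<integral>p. ?f n p \<partial>(D \<Otimes>\<^sub>M S)) \<longlonglongrightarrow> (\<integral>p. fst p * indicator ?A (snd p) \<partial>(D \<Otimes>\<^sub>M S))"
  proof (rule integral_dominated_convergence)
    show "integrable (D \<Otimes>\<^sub>M S) (\<lambda>p. norm (fst p))"
      using integrable_fst_D by (intro integrable_norm)
  next
    show "AE p in D \<Otimes>\<^sub>M S. (\<lambda>n. ?f n p) \<longlonglongrightarrow> fst p * indicator ?A (snd p)"
      by (rule AE_I2) (rule lim)
    show "AE p in D \<Otimes>\<^sub>M S. norm (?f n p) \<le> norm (fst p)" for n
      by (rule AE_I2) (rule bound)
  qed measurable
  then have "0 \<le> (\<integral>p. fst p * indicator ?A (snd p) \<partial>(D \<Otimes>\<^sub>M S))"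
    by (rule LIMSEQ_le_const) (use integral_increment_nonneg in blast)
  also have "\<dots> = (\<integral>x. (\<integral>\<omega>. x * indicator ?A \<omega> \<partial>S) \<partial>D)"
  proof (subst DS.integral_fst'[symmetric])
    show "integrable (D \<Otimes>\<^sub>M S) (\<lambda>p. fst p * indicator ?A (snd p))"
      by (rule Bochner_Integration.integrable_bound[OF integrable_fst_D]) (auto simp: indicator_def)
  qed simp
  also have "\<dots> = (\<integral>x. x \<partial>D) * P.prob ?A"
    by simp
  finally have "P.prob ?A = 0"
    using assms measure_nonneg[of S ?A] by (simp add: zero_le_mult_iff)
  then have "AE \<omega> in S. \<omega> \<notin> ?A"
    by (simp add: P.prob_eq_0)
  then show ?thesis
  proof eventually_elim
    case (elim \<omega>)
    then obtain B where "max_sum n \<omega> \<le> B" for n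
      by (auto simp: unbounded_sums_def bdd_above_def)
    then show ?case using sum_le_max_sum order_trans by blast
  qed
qed

end

section \<open>The strong law of large numbers\<close>

lemma distr_compose_cong:
  assumes "distr M N X = distr M N Y"
    and "X \<in> measurable M N" "Y \<in> measurable M N" "f \<in> measurable N K"
  shows "distr M K (\<lambda>\<omega>. f (X \<omega>)) = distr M K (\<lambda>\<omega>. f (Y \<omega>))"
  using distr_distr[OF assms(4,2)] distr_distr[OF assms(4,3)] assms(1) by (simp add: comp_def)

lemma (in prob_space) AE_bounded_sums_of_negative_mean:
  fixes X :: "nat \<Rightarrow> 'a \<Rightarrow> real"
  assumes indep: "indep_vars (\<lambda>_. borel) X UNIV"
    and distr: "\<And>n. distr M borel (X n) = D"
    and int: "integrable D (\<lambda>x. x)" and neg: "(\<integral>x. x \<partial>D) < 0"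
  shows "AE \<omega> in M. \<exists>B. \<forall>n. (\<Sum>k<n. X k \<omega>) \<le> B"
proof -
  have [measurable]: "X n \<in> borel_measurable M" for n
    using indep by (auto simp: indep_vars_def)
  have prob_D: "prob_space D"
    using prob_space_distr[of "X 0" borel] distr by simp
  have sets_D: "sets D = sets borel"
    using distr[of 0] by (metis sets_distr)
  have "sequence_space D"
    unfolding sequence_space_def using prob_D by (rule product_prob_spaceI)
  then interpret D: real_iid D
    using sets_D int by (simp add: real_iid_def real_iid_axioms_def)
  have law: "distr M (\<Pi>\<^sub>M i\<in>UNIV. borel) (\<lambda>\<omega> i. X i \<omega>) = D.S"
    using indep_vars_iff_distr_eq_PiM[where I = UNIV and M' = "\<lambda>_. borel" and X = X] indep by (simp add: distr restrict_def)
  have "AE \<omega> in distr M (\<Pi>\<^sub>M i\<in>UNIV. borel) (\<lambda>\<omega> i. X i \<omega>). \<exists>B. \<forall>n. (\<Sum>k<n. \<omega> k) \<le> B"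
    unfolding law using neg by (rule D.AE_bounded_sums)
  then show ?thesis
    by (rule AE_distrD[rotated]) (rule measurable_PiM_single', auto)
qed

text \<open>
  Subtracting \<open>expectation Y + e / 2\<close> from every step makes the mean negative, so the sums stay below
  \<open>n * (expectation Y + e / 2) + B\<close>, and half of \<open>e\<close> is left to absorb the constant \<open>B / n\<close>.
\<close>
lemma (in prob_space) strong_law_upper:
  fixes X :: "nat \<Rightarrow> 'a \<Rightarrow> real"
  assumes indep: "indep_vars (\<lambda>_. borel) X UNIV"
    and distr: "\<And>n. distr M borel (X n) = distr M borel Y"
    and int: "integrable M Y" and e: "0 < e"
  shows "AE \<omega> in M. \<forall>\<^sub>F n in sequentially. (\<Sum>k<n. X k \<omega>) / n < expectation Y + e"
proof -
  let ?c = "expectation Y + e / 2"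
  note [measurable] = borel_measurable_integrable[OF int]
  have [measurable]: "X n \<in> borel_measurable M" for n
    using indep by (auto simp: indep_vars_def)
  have "AE \<omega> in M. \<exists>B. \<forall>n. (\<Sum>k<n. X k \<omega> - ?c) \<le> B"
  proof (rule AE_bounded_sums_of_negative_mean)
    show "indep_vars (\<lambda>_. borel) (\<lambda>k \<omega>. X k \<omega> - ?c) UNIV"
      by (rule indep_vars_compose2[OF indep]) auto
    show "distr M borel (\<lambda>\<omega>. X n \<omega> - ?c) = distr M borel (\<lambda>\<omega>. Y \<omega> - ?c)" for n
      by (rule distr_compose_cong[OF distr]) auto
    show "integrable (distr M borel (\<lambda>\<omega>. Y \<omega> - ?c)) (\<lambda>x. x)"
      using int by (subst integrable_distr_eq) auto
    show "(\<integral>x. x \<partial>distr M borel (\<lambda>\<omega>. Y \<omega> - ?c)) < 0"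
      using int e by (subst integral_distr) (auto simp: prob_space)
  qed
  then show ?thesis
  proof eventually_elim
    case (elim \<omega>)
    then obtain B where B: "(\<Sum>k<n. X k \<omega> - ?c) \<le> B" for n by blast
    have "\<forall>\<^sub>F n in sequentially. 2 * B / e < real n"
      by (rule filterlim_at_top_dense[THEN iffD1, rule_format, OF filterlim_real_sequentially])
    then show ?case
      using eventually_gt_at_top[of 0]
    proof eventually_elim
      case (elim n)
      have "(\<Sum>k<n. X k \<omega>) \<le> B + n * ?c"
        using B[of n] by (simp add: sum_subtractf)
      also have "\<dots> < n * (expectation Y + e)"
        using elim e by (simp add: field_simps)
      finally show ?case using elim by (simp add: field_simps)
    qed
  qed
qed

text \<open>
  The upper bound, applied to the steps and to their negatives, for a countable set of errors.
\<close>
theorem (in prob_space) strong_law_of_large_numbers: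
  fixes X :: "nat \<Rightarrow> 'a \<Rightarrow> real"
  assumes indep: "indep_vars (\<lambda>_. borel) X UNIV"
    and distr: "\<And>n. distr M borel (X n) = distr M borel Y"
    and int: "integrable M Y"
  shows "AE \<omega> in M. (\<lambda>n. (\<Sum>k<n. X k \<omega>) / n) \<longlonglongrightarrow> expectation Y"
proof -
  note [measurable] = borel_measurable_integrable[OF int]
  have [measurable]: "X n \<in> borel_measurable M" for n
    using indep by (auto simp: indep_vars_def)
  have upper: "AE \<omega> in M. \<forall>i. \<forall>\<^sub>F n in sequentially.
      (\<Sum>k<n. X k \<omega>) / n < expectation Y + inverse (Suc i)"
    unfolding AE_all_countable
    by (intro allI strong_law_upper[OF indep distr int]) auto
  have lower: "AE \<omega> in M. \<forall>i. \<forall>\<^sub>F n in sequentially.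
      (\<Sum>k<n. - X k \<omega>) / n < expectation (\<lambda>\<omega>. - Y \<omega>) + inverse (Suc i)"
    unfolding AE_all_countable
  proof (intro allI strong_law_upper)
    show "indep_vars (\<lambda>_. borel) (\<lambda>k \<omega>. - X k \<omega>) UNIV"
      by (rule indep_vars_compose2[OF indep]) auto
    show "distr M borel (\<lambda>\<omega>. - X n \<omega>) = distr M borel (\<lambda>\<omega>. - Y \<omega>)" for n
      by (rule distr_compose_cong[OF distr]) auto
  qed (use int in auto)
  from upper lower show ?thesis
  proof eventually_elim
    case (elim \<omega>)
    show ?case
    proof (rule tendstoI)
      fix e :: real assume "0 < e"
      then obtain i where i: "inverse (real (Suc i)) < e"
        using reals_Archimedean by blast
      from elim(1)[rule_format, of i] elim(2)[rule_format, of i]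
      show "\<forall>\<^sub>F n in sequentially. dist ((\<Sum>k<n. X k \<omega>) / n) (expectation Y) < e"
        by eventually_elim (use i in \<open>auto simp: dist_real_def sum_negf abs_less_iff\<close>)
    qed
  qed
qed

section \<open>Projections of convex polygons\<close>

definition perp :: "real^2 \<Rightarrow> real^2" where
  "perp w = vector [- (w $ 2), w $ 1]"

lemma inner_perp_self [simp]: "w \<bullet> perp w = 0"
  by (simp add: perp_def inner_vec_def sum_2)

lemma norm_perp [simp]: "norm (perp w) = norm w"
  by (simp add: perp_def norm_eq_sqrt_inner inner_vec_def sum_2)

lemma norm_le_inner_perp:
  assumes "norm u = 1"
  shows "norm x \<le> \<bar>u \<bullet> x\<bar> + \<bar>perp u \<bullet> x\<bar>"
proof -
  have u: "(u $ 1)\<^sup>2 + (u $ 2)\<^sup>2 = 1"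
    using assms by (simp add: norm_eq_sqrt_inner inner_vec_def sum_2 power2_eq_square)
  \<comment> \<open>The Pythagorean identity for the orthonormal pair \<open>u\<close>, \<open>perp u\<close>.\<close>
  have "(norm x)\<^sup>2 = ((u $ 1)\<^sup>2 + (u $ 2)\<^sup>2) * ((x $ 1)\<^sup>2 + (x $ 2)\<^sup>2)"
    unfolding u power2_norm_eq_inner by (simp add: inner_vec_def sum_2 power2_eq_square)
  also have "\<dots> = (u \<bullet> x)\<^sup>2 + (perp u \<bullet> x)\<^sup>2"
    by (simp add: perp_def inner_vec_def sum_2 power2_eq_square algebra_simps)
  also have "\<dots> \<le> (\<bar>u \<bullet> x\<bar> + \<bar>perp u \<bullet> x\<bar>)\<^sup>2"
    by (simp add: power2_sum)
  finally show ?thesis by (rule power2_le_imp_le) simp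
qed

lemma edge_of_closed_segment:
  fixes P :: "'a::euclidean_space set"
  assumes "e edge_of P" "compact P" "convex P"
  obtains a b where "e = closed_segment a b" "a extreme_point_of P" "b extreme_point_of P"
proof -
  have e: "e face_of P" "aff_dim e = 1"
    using assms(1) by (auto simp: edge_of_def)
  then have "e \<noteq> {}" by auto
  moreover have "compact e" "convex e"
    using e assms face_of_imp_compact face_of_imp_convex by blast+
  moreover have "collinear e" using e by (simp add: collinear_aff_dim)
  ultimately obtain a b where ab: "e = closed_segment a b"
    by (rule compact_convex_collinear_segment)
  moreover have "x extreme_point_of P" if "x \<in> {a, b}" for x
    using that e(1) extreme_point_of_face[OF e(1)] unfolding ab
    by (auto simp: extreme_point_of_segment)
  ultimately show ?thesis using that by blast
qed

text \<open>
  Some interior point lies on the hyperplane or on one side of it. In the latter case the segment to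
  the point of the convex set on the other side consists of interior points up to its end, and crosses
  the hyperplane before.
\<close>
lemma interior_meets_line:
  fixes P :: "'a::euclidean_space set"
  assumes "convex P" "interior P \<noteq> {}"
    and x: "x \<in> P" "w \<bullet> x < t" and y: "y \<in> P" "t < w \<bullet> y"
  obtains z where "z \<in> interior P" "w \<bullet> z = t"
proof -
  obtain z0 where z0: "z0 \<in> interior P" using assms by auto
  have *: "\<exists>z\<in>interior P. w \<bullet> z = t"
    if "v \<in> P" and t: "t \<in> open_segment (w \<bullet> z0) (w \<bullet> v)" for v
  proof -
    have "open_segment z0 v \<subseteq> interior P"
      using that closure_subset by (intro in_interior_closure_convex_segment z0 assms) auto
    moreover obtain s where s: "0 < s" "s < 1" "t = (1 - s) * (w \<bullet> z0) + s * (w \<bullet> v)"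
      and ne: "w \<bullet> z0 \<noteq> w \<bullet> v"
      using t by (auto simp: in_segment)
    moreover have "(1 - s) *\<^sub>R z0 + s *\<^sub>R v \<in> open_segment z0 v"
      using s ne by (auto simp: in_segment)
    moreover have "w \<bullet> ((1 - s) *\<^sub>R z0 + s *\<^sub>R v) = t"
      using s by (simp add: inner_add_right)
    ultimately show ?thesis by blast
  qed
  consider "w \<bullet> z0 = t" | "w \<bullet> z0 < t" | "t < w \<bullet> z0" by linarith
  then have "\<exists>z\<in>interior P. w \<bullet> z = t"
  proof cases
    case 2
    with y show ?thesis by (intro *[of y]) (auto simp: open_segment_eq_real_ivl)
  next
    case 3
    with x show ?thesis by (intro *[of x]) (auto simp: open_segment_eq_real_ivl)
  qed (use z0 in auto)
  then show ?thesis using that by blast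
qed

text \<open>
  The intersection of two distinct edges is a face of smaller dimension, thus a vertex.
\<close>
lemma edges_disjoint_off_vertices:
  fixes P :: "'a::euclidean_space set"
  assumes "e edge_of P" "e' edge_of P" "e \<noteq> e'" "p \<in> e" "p \<in> e'"
  shows "p extreme_point_of P"
proof -
  have e: "e face_of P" "e' face_of P" "aff_dim e = 1" "aff_dim e' = 1"
    using assms by (auto simp: edge_of_def)
  have I: "(e \<inter> e') face_of P" using e by (intro face_of_Int)
  have fe: "(e \<inter> e') face_of e" "(e \<inter> e') face_of e'"
    using I e face_of_face by (metis Int_lower1, metis Int_lower2)
  have "aff_dim (e \<inter> e') < 1"
  proof (cases "e \<inter> e' = e")
    case True
    then have "e \<inter> e' \<noteq> e'" using assms by blast
    then show ?thesis using face_of_aff_dim_lt[OF _ fe(2)] e face_of_imp_convex by metis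
  next
    case False
    then show ?thesis using face_of_aff_dim_lt[OF _ fe(1)] e face_of_imp_convex by metis
  qed
  moreover have "aff_dim (e \<inter> e') \<ge> 0"
  proof -
    have "e \<inter> e' \<noteq> {}" using assms(4,5) by blast
    then show ?thesis by (simp add: aff_dim_negative_iff flip: not_less)
  qed
  ultimately have "aff_dim (e \<inter> e') = 0" by simp
  then obtain a where "e \<inter> e' = {a}" by (auto simp: aff_dim_eq_0)
  then have "e \<inter> e' = {p}" using assms(4,5) by auto
  then show ?thesis using I by (simp add: face_of_singleton)
qed

text \<open>
  Along an edge \<open>(\<bullet>) w\<close> is affine; it is not constantly \<open>t\<close>, since it differs from \<open>t\<close> at the end
  points, which are vertices. So it takes the value \<open>t\<close> at most once.
\<close>
lemma edge_meets_line_once: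
  fixes P :: "'a::euclidean_space set"
  assumes "e edge_of P" "compact P" "convex P"
    and t: "t \<notin> (\<bullet>) w ` {x. x extreme_point_of P}"
    and "x \<in> e" "y \<in> e" "w \<bullet> x = t" "w \<bullet> y = t"
  shows "x = y"
proof -
  obtain a b where ab: "e = closed_segment a b" "a extreme_point_of P" "b extreme_point_of P"
    using assms by (metis edge_of_closed_segment)
  have ta: "w \<bullet> a \<noteq> t" using t ab by auto
  obtain r where r: "x = (1 - r) *\<^sub>R a + r *\<^sub>R b" using assms(5) ab by (auto simp: in_segment)
  obtain s where s: "y = (1 - s) *\<^sub>R a + s *\<^sub>R b" using assms(6) ab by (auto simp: in_segment)
  have 1: "w \<bullet> a + r * (w \<bullet> b - w \<bullet> a) = t" "w \<bullet> a + s * (w \<bullet> b - w \<bullet> a) = t"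
    using assms(7,8) unfolding r s by (simp_all add: inner_add_right algebra_simps)
  then have "(r - s) * (w \<bullet> b - w \<bullet> a) = 0" by (simp add: algebra_simps)
  moreover have "w \<bullet> b - w \<bullet> a \<noteq> 0" using 1 ta by auto
  ultimately show ?thesis using r s by simp
qed

text \<open>
  The line cuts the polygon in a segment with two distinct end points, whose relative interior lies in
  the interior of the polygon. The end points are boundary points, so each lies on an edge, and on
  only one because the line avoids the vertices. Conversely, an edge that meets the line does so in a
  single point; this is a face of the segment, hence one of its end points.
\<close>
lemma card_edges_meeting_line:
  fixes P :: "(real^2) set"
  assumes "polytope P" "aff_dim P = 2" "w \<noteq> 0"
    and x: "x \<in> P" "w \<bullet> x < t" and y: "y \<in> P" "t < w \<bullet> y"
    and t: "t \<notin> (\<bullet>) w ` {x. x extreme_point_of P}"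
  shows "card {e. e edge_of P \<and> t \<in> (\<bullet>) w ` e} = 2"
proof -
  have P: "compact P" "convex P" "closed P" "polyhedron P"
    using assms polytope_imp_compact polytope_imp_convex polytope_imp_closed polytope_imp_polyhedron
    by blast+
  have int: "interior P = rel_interior P"
    using assms by (intro interior_rel_interior[symmetric]) simp
  have "P \<noteq> {}" using x by auto
  then have int_ne: "interior P \<noteq> {}"
    using int P(2) rel_interior_eq_empty by metis
  define l where "l = {z. w \<bullet> z = t}"
  have l: "affine l" "closed l" "aff_dim l = 1"
    unfolding l_def using assms by (auto simp: affine_hyperplane closed_hyperplane)
  obtain z where z: "z \<in> interior P" "z \<in> l"
    using interior_meets_line[OF P(2) int_ne x y] by (auto simp: l_def)
  have "z \<in> P" using z interior_subset by blast
  have slice: "rel_interior (P \<inter> l) = interior P \<inter> l"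
    using z P l by (intro rel_interior_convex_Int_affine) auto
  have "collinear (P \<inter> l)"
    using aff_dim_subset[of "P \<inter> l" l] l by (simp add: collinear_aff_dim)
  moreover have "P \<inter> l \<noteq> {}" "compact (P \<inter> l)" "convex (P \<inter> l)"
    using z \<open>z \<in> P\<close> P l by (auto intro: compact_Int_closed convex_Int affine_imp_convex)
  ultimately obtain p q where pq: "P \<inter> l = closed_segment p q"
    by (metis compact_convex_collinear_segment)
  \<comment> \<open>Moving a little from the interior point \<open>z\<close> along the line stays inside the polygon.\<close>
  have "p \<noteq> q"
  proof
    assume "p = q"
    then have sing: "P \<inter> l = {z}" using pq z \<open>z \<in> P\<close> by auto
    obtain r where r: "0 < r" "ball z r \<subseteq> P"
      using z(1) by (meson mem_interior)
    let ?z = "z + (r / (2 * norm w)) *\<^sub>R perp w"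
    have "norm ((r / (2 * norm w)) *\<^sub>R perp w) < r"
      using r assms by simp
    then have "?z \<in> ball z r" by (simp add: dist_norm)
    moreover have "?z \<in> l" using z by (simp add: l_def inner_add_right)
    ultimately have "?z = z" using r sing by blast
    then have "perp w = 0" using r assms by simp
    then show False using assms norm_perp[of w] by simp
  qed
  \<comment> \<open>The two end points of the slice lie on the boundary, which is the union of the edges.\<close>
  have extr: "\<exists>e. e edge_of P \<and> v \<in> e" if v: "v \<in> {p, q}" for v
  proof -
    have "v extreme_point_of (P \<inter> l)"
      using v unfolding pq by (auto simp: extreme_point_of_segment)
    moreover have "P \<inter> l \<noteq> {v}"
      using pq \<open>p \<noteq> q\<close> by (metis ends_in_segment singletonD)
    ultimately have "v \<notin> rel_interior (P \<inter> l)"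
      by (rule extreme_point_not_in_REL_INTERIOR)
    moreover have vP: "v \<in> P" "v \<in> l" using v pq by auto
    ultimately have "v \<in> rel_frontier P"
      using slice int closure_subset by (auto simp: rel_frontier_def)
    then obtain e where "e facet_of P" "v \<in> e"
      using rel_frontier_of_polyhedron[OF P(4)] by auto
    then show ?thesis using assms by (auto simp: facet_of_def edge_of_def)
  qed
  obtain e1 where e1: "e1 edge_of P" "p \<in> e1" using extr by blast
  obtain e2 where e2: "e2 edge_of P" "q \<in> e2" using extr by blast
  have pql: "w \<bullet> p = t" "w \<bullet> q = t" using pq by (auto simp: l_def)
  have "e1 \<noteq> e2"
    using edge_meets_line_once[OF e1(1) P(1,2) t e1(2), of q] pql e2 \<open>p \<noteq> q\<close> by blast
  have unique: "e = e'" if "e edge_of P" "e' edge_of P" "v \<in> e" "v \<in> e'" "w \<bullet> v = t" for e e' v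
    using edges_disjoint_off_vertices[OF that(1,2) _ that(3,4)] that(5) t by blast
  have "{e. e edge_of P \<and> t \<in> (\<bullet>) w ` e} = {e1, e2}"
  proof (intro equalityI subsetI)
    fix e assume "e \<in> {e. e edge_of P \<and> t \<in> (\<bullet>) w ` e}"
    then obtain v where e: "e edge_of P" and v: "v \<in> e" "w \<bullet> v = t" by auto
    have "(e \<inter> l) face_of (P \<inter> l)"
      using e l by (intro face_of_slice) (auto simp: edge_of_def affine_imp_convex)
    moreover have "e \<inter> l = {v}"
      using edge_meets_line_once[OF e P(1,2) t] v by (auto simp: l_def)
    ultimately have "v extreme_point_of closed_segment p q"
      by (simp add: face_of_singleton pq)
    then have "v = p \<or> v = q" by (simp add: extreme_point_of_segment)
    then show "e \<in> {e1, e2}" using unique e v e1 e2 pql by blast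
  next
    fix e assume "e \<in> {e1, e2}"
    then show "e \<in> {e. e edge_of P \<and> t \<in> (\<bullet>) w ` e}" using e1 e2 pql by (auto intro: image_eqI[OF sym])
  qed
  then show ?thesis using \<open>e1 \<noteq> e2\<close> by simp
qed

lemma finite_extreme_points_polytope:
  assumes "polytope P"
  shows "finite {x. x extreme_point_of P}"
proof -
  obtain V where "finite V" "P = convex hull V"
    using assms by (auto simp: polytope_def)
  then show ?thesis
    using extreme_point_of_convex_hull by (auto intro: finite_subset[of _ V])
qed

lemma finite_edges_polytope:
  fixes P :: "'a::euclidean_space set"
  assumes "polytope P"
  shows "finite {e. e edge_of P}"
  using finite_polytope_faces[OF assms] by (rule rev_finite_subset) (auto simp: edge_of_def)

lemma inner_image_interval:
  fixes S :: "'a::euclidean_space set"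
  assumes "compact S" "connected S"
  obtains c d where "(\<bullet>) w ` S = {c..d}"
proof -
  have "compact ((\<bullet>) w ` S)" "connected ((\<bullet>) w ` S)"
    by (intro compact_continuous_image connected_continuous_image continuous_intros assms)+
  then show ?thesis
    using that connected_compact_interval_1[of "(\<bullet>) w ` S"] by auto
qed

lemma edge_of_polytope:
  fixes P :: "'a::euclidean_space set"
  assumes "e edge_of P" "polytope P"
  shows "compact e" "connected e" "e \<noteq> {}"
proof -
  have "polytope e" using assms by (auto simp: edge_of_def intro: face_of_polytope_polytope)
  then show "compact e" "connected e"
    using polytope_imp_compact polytope_imp_convex convex_connected by blast+
  show "e \<noteq> {}" using assms by (auto simp: edge_of_def)
qed

text \<open>
  Both sides integrate, over the positions \<open>t\<close> of a line orthogonal to \<open>w\<close>, the number of crossings with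
  the boundary: for all but finitely many \<open>t\<close> there are two if \<open>t\<close> lies in the projection of the polygon,
  and none otherwise.
\<close>
lemma sum_edges_projection:
  fixes P :: "(real^2) set"
  assumes "polytope P" "aff_dim P = 2" "w \<noteq> 0"
  shows "(\<Sum>e | e edge_of P. measure lborel ((\<bullet>) w ` e)) = 2 * measure lborel ((\<bullet>) w ` P)"
proof -
  have P: "compact P" "convex P"
    using assms polytope_imp_compact polytope_imp_convex by blast+
  note fin = finite_edges_polytope[OF assms(1)]
  obtain m M where mM: "(\<bullet>) w ` P = {m..M}"
    using inner_image_interval[OF P(1) convex_connected[OF P(2)]] by blast
  \<comment> \<open>The exceptional positions: lines through a vertex, and the two supporting lines.\<close>
  define N where "N = insert m (insert M ((\<bullet>) w ` {x. x extreme_point_of P}))"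
  have count: "(\<Sum>e | e edge_of P. indicator ((\<bullet>) w ` e) t) = 2 * (indicator ((\<bullet>) w ` P) t :: real)"
    if t: "t \<notin> N" for t
  proof -
    have "(\<Sum>e | e edge_of P. indicator ((\<bullet>) w ` e) t)
        = (\<Sum>e | e edge_of P. if t \<in> (\<bullet>) w ` e then 1 else 0 :: real)"
      by (intro sum.cong) (auto simp: indicator_def)
    also have "\<dots> = real (card {e. e edge_of P \<and> t \<in> (\<bullet>) w ` e})"
      using fin by (subst sum.inter_filter[symmetric]) auto
    also have "\<dots> = 2 * indicator ((\<bullet>) w ` P) t"
    proof (cases "t \<in> (\<bullet>) w ` P")
      case True
      then have "m < t" "t < M" "m \<in> (\<bullet>) w ` P" "M \<in> (\<bullet>) w ` P"
        using t unfolding mM N_def by (auto simp: less_le)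
      then obtain x y where "x \<in> P" "w \<bullet> x < t" "y \<in> P" "t < w \<bullet> y" by auto
      then have "card {e. e edge_of P \<and> t \<in> (\<bullet>) w ` e} = 2"
        using t by (intro card_edges_meeting_line[OF assms]) (auto simp: N_def)
      then show ?thesis using True by simp
    next
      case False
      then have "{e. e edge_of P \<and> t \<in> (\<bullet>) w ` e} = {}"
        using edge_of_imp_subset by blast
      then show ?thesis using False by (simp only: card.empty) simp
    qed
    finally show ?thesis .
  qed
  have ind: "integrable lborel (indicator ((\<bullet>) w ` e) :: real \<Rightarrow> real)" if e: "e edge_of P" for e
  proof -
    obtain c d where cd: "(\<bullet>) w ` e = {c..d}"
      using inner_image_interval[OF edge_of_polytope(1,2)[OF e assms(1)]] by blast
    show ?thesis
      unfolding cd by (intro integrable_real_indicator emeasure_bounded_finite) simp_all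
  qed
  have "(\<Sum>e | e edge_of P. measure lborel ((\<bullet>) w ` e))
      = (\<Sum>e | e edge_of P. \<integral>t. indicator ((\<bullet>) w ` e) t \<partial>lborel)"
    by simp
  also have "\<dots> = (\<integral>t. (\<Sum>e | e edge_of P. indicator ((\<bullet>) w ` e) t) \<partial>lborel)"
    by (rule Bochner_Integration.integral_sum[symmetric]) (rule ind, simp)
  also have "\<dots> = (\<integral>t. 2 * indicator ((\<bullet>) w ` P) t \<partial>lborel)"
  proof (rule integral_cong_AE)
    have "finite N"
      unfolding N_def using finite_extreme_points_polytope[OF assms(1)] by simp
    then have "AE t in lborel. t \<notin> N"
      by (intro AE_not_in finite_imp_null_set_lborel)
    then show "AE t in lborel. (\<Sum>e | e edge_of P. indicator ((\<bullet>) w ` e) t) = 2 * (indicator ((\<bullet>) w ` P) t :: real)"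
      by eventually_elim (rule count)
  next
    show "(\<lambda>t. \<Sum>e | e edge_of P. indicator ((\<bullet>) w ` e) t :: real) \<in> borel_measurable lborel"
      by (rule borel_measurable_sum) (rule borel_measurable_integrable, rule ind, simp)
    show "(\<lambda>t. 2 * indicator ((\<bullet>) w ` P) t :: real) \<in> borel_measurable lborel"
      unfolding mM by simp
  qed
  finally show ?thesis by simp
qed

lemma measure_inner_image_le:
  fixes S :: "'a::euclidean_space set"
  assumes "compact S" "connected S" "S \<noteq> {}"
  shows "measure lborel ((\<bullet>) w ` S) \<le> norm w * diameter S"
proof -
  obtain c d where cd: "(\<bullet>) w ` S = {c..d}"
    using inner_image_interval[OF assms(1,2)] by blast
  with assms have "c \<le> d" by auto
  then have "c \<in> (\<bullet>) w ` S" "d \<in> (\<bullet>) w ` S" unfolding cd by auto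
  then obtain x y where xy: "x \<in> S" "c = w \<bullet> x" "y \<in> S" "d = w \<bullet> y" by auto
  have "d - c = w \<bullet> (y - x)" using xy by (simp add: inner_diff_right)
  also have "\<dots> \<le> norm w * dist y x"
    unfolding dist_norm by (rule norm_cauchy_schwarz)
  also have "\<dots> \<le> norm w * diameter S"
    using xy assms by (intro mult_left_mono diameter_bounded_bound compact_imp_bounded) auto
  finally show ?thesis using \<open>c \<le> d\<close> by (simp add: cd)
qed

lemma inner_diff_le_measure_image:
  fixes S :: "'a::euclidean_space set"
  assumes "compact S" "connected S" "x \<in> S" "y \<in> S"
  shows "\<bar>w \<bullet> (x - y)\<bar> \<le> measure lborel ((\<bullet>) w ` S)"
proof -
  obtain c d where cd: "(\<bullet>) w ` S = {c..d}"
    using inner_image_interval[OF assms(1,2)] by blast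
  then have "w \<bullet> x \<in> {c..d}" "w \<bullet> y \<in> {c..d}"
    using assms(3,4) by (auto simp flip: cd)
  then show ?thesis by (auto simp: cd inner_diff_right)
qed

lemma diameter_le_measure_projections:
  fixes S :: "(real^2) set"
  assumes "compact S" "connected S" "S \<noteq> {}" "norm u = 1"
  shows "diameter S \<le> measure lborel ((\<bullet>) u ` S) + measure lborel ((\<bullet>) (perp u) ` S)"
proof -
  obtain x y where xy: "x \<in> S" "y \<in> S" "dist x y = diameter S"
    using diameter_compact_attained assms by metis
  have "diameter S \<le> \<bar>u \<bullet> (x - y)\<bar> + \<bar>perp u \<bullet> (x - y)\<bar>"
    using norm_le_inner_perp[OF assms(4), of "x - y"] xy by (simp add: dist_norm)
  also have "\<dots> \<le> measure lborel ((\<bullet>) u ` S) + measure lborel ((\<bullet>) (perp u) ` S)"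
    using xy assms by (intro add_mono inner_diff_le_measure_image)
  finally show ?thesis .
qed

section \<open>Perimeter and diameter\<close>

text \<open>
  Project to the direction of a diameter: projections shorten the edges, and the image of the polygon
  has the length of the diameter.
\<close>
lemma two_diameter_le_perimeter:
  assumes "polytope P"
  shows "2 * diameter P \<le> polygon_perimeter P"
proof (cases "aff_dim P = 2 \<and> diameter P > 0")
  \<comment> \<open>A diameter of 0 gives no direction to project to, but then the bound is trivial.\<close>
  case False
  moreover have "0 \<le> diameter e" if "e edge_of P" for e
    using edge_of_polytope[OF that assms] by (simp add: diameter_ge_0 compact_imp_bounded)
  ultimately show ?thesis
    using sum_nonneg[of "{e. e edge_of P}" diameter] by (auto simp: polygon_perimeter_def)
next
  case True
  have P: "compact P" "connected P" "P \<noteq> {}"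
    using assms True polytope_imp_compact polytope_imp_convex convex_connected by auto
  obtain x y where xy: "x \<in> P" "y \<in> P" "dist x y = diameter P"
    using diameter_compact_attained P by metis
  define w where "w = (x - y) /\<^sub>R diameter P"
  have w: "norm w = 1" "w \<bullet> (x - y) = diameter P"
    using xy True by (auto simp: w_def dist_norm simp flip: power2_norm_eq_inner)
       (simp add: power2_eq_square)
  have "2 * diameter P \<le> 2 * measure lborel ((\<bullet>) w ` P)"
    using inner_diff_le_measure_image[OF P(1,2) xy(1,2), of w] w by simp
  also have "\<dots> = (\<Sum>e | e edge_of P. measure lborel ((\<bullet>) w ` e))"
    using w True assms by (subst sum_edges_projection) auto
  also have "\<dots> \<le> (\<Sum>e | e edge_of P. diameter e)"
    using measure_inner_image_le[of _ w] edge_of_polytope[OF _ assms] w by (intro sum_mono) auto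
  finally show ?thesis using True by (simp add: polygon_perimeter_def)
qed

text \<open>
  An edge is at most as long as its projections to two orthogonal directions together, and the
  polygon is nowhere wider than its diameter.
\<close>
lemma perimeter_le_diameter_plus_width:
  assumes "polytope P" "P \<noteq> {}" "norm u = 1"
  shows "polygon_perimeter P \<le> 2 * diameter P + 2 * measure lborel ((\<bullet>) (perp u) ` P)"
proof (cases "aff_dim P = 2")
  case False
  then show ?thesis by (simp add: polygon_perimeter_def)
next
  case True
  have P: "compact P" "connected P"
    using assms polytope_imp_compact polytope_imp_convex convex_connected by auto
  have "u \<noteq> 0" "perp u \<noteq> 0" using assms(3) norm_perp[of u] by fastforce+
  have "polygon_perimeter P
      \<le> (\<Sum>e | e edge_of P. measure lborel ((\<bullet>) u ` e) + measure lborel ((\<bullet>) (perp u) ` e))"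
    unfolding polygon_perimeter_def using True edge_of_polytope[OF _ assms(1)] assms(3)
    by (auto intro!: sum_mono diameter_le_measure_projections)
  also have "\<dots> = 2 * measure lborel ((\<bullet>) u ` P) + 2 * measure lborel ((\<bullet>) (perp u) ` P)"
    using True assms \<open>u \<noteq> 0\<close> \<open>perp u \<noteq> 0\<close> by (simp add: sum.distrib sum_edges_projection)
  also have "\<dots> \<le> 2 * diameter P + 2 * measure lborel ((\<bullet>) (perp u) ` P)"
    using measure_inner_image_le[OF P assms(2), of u] assms(3) by simp
  finally show ?thesis .
qed

text \<open>
  Indices from some \<open>K\<close> on are controlled by the limit, and the finitely many before it have a
  common bound, which is below \<open>e * n\<close> once \<open>n\<close> is large.
\<close>
lemma sublinear_running_max:
  fixes a :: "nat \<Rightarrow> real" and e :: real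
  assumes "(\<lambda>n. a n / n) \<longlonglongrightarrow> 0" "a 0 = 0" "0 < e"
  shows "\<forall>\<^sub>F n in sequentially. \<forall>k\<le>n. \<bar>a k\<bar> \<le> e * n"
proof -
  obtain K where K: "\<And>k. k \<ge> K \<Longrightarrow> \<bar>a k / k\<bar> < e"
    using LIMSEQ_D[OF assms(1,3)] by auto
  define C where "C = (\<Sum>k<K. \<bar>a k\<bar>)"
  have "\<forall>\<^sub>F n in sequentially. C / e < real n"
    by (rule filterlim_at_top_dense[THEN iffD1, rule_format, OF filterlim_real_sequentially])
  then show ?thesis
  proof eventually_elim
    case (elim n)
    have "\<bar>a k\<bar> \<le> e * n" if "k \<le> n" for k
    proof (cases "k < K")
      case True
      then have "\<bar>a k\<bar> \<le> C"
        unfolding C_def by (intro member_le_sum) auto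
      also have "C \<le> e * n" using elim assms(3) by (simp add: field_simps)
      finally show ?thesis .
    next
      case False
      show ?thesis
      proof (cases "k = 0")
        case False
        then have "\<bar>a k\<bar> \<le> e * k" using K[of k] \<open>\<not> k < K\<close> by (simp add: field_simps)
        also have "\<dots> \<le> e * n" using that assms(3) by simp
        finally show ?thesis .
      qed (use assms in simp)
    qed
    then show ?case by blast
  qed
qed

text \<open>
  For large \<open>n\<close> the diameter exceeds \<open>c / 2 * n\<close>, as the last point is already that far from the
  origin, while the hull lies in the strip of half width \<open>d * n\<close> around the line spanned by \<open>u\<close>.
  The ratio then lies between \<open>2\<close> and \<open>2 + 8 * d / c\<close>.
\<close>
theorem perimeter_over_diameter_tendsto:
  fixes s :: "nat \<Rightarrow> real^2"
  defines "H \<equiv> \<lambda>n. convex hull (s ` {0..n})"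
  assumes u: "norm u = 1" and s0: "s 0 = 0" and c: "0 < c"
    and along: "(\<lambda>n. (u \<bullet> s n) / n) \<longlonglongrightarrow> c"
    and across: "(\<lambda>n. (perp u \<bullet> s n) / n) \<longlonglongrightarrow> 0"
  shows "(\<lambda>n. polygon_perimeter (H n) / diameter (H n)) \<longlonglongrightarrow> 2"
proof (rule tendstoI)
  fix e :: real assume e: "0 < e"
  \<comment> \<open>Chosen so that the excess \<open>4 * d * n\<close> is \<open>e\<close> times the lower bound \<open>c / 2 * n\<close> for the diameter.\<close>
  define d where "d = e * c / 8"
  have d: "0 < d" using e c by (simp add: d_def)
  have poly: "polytope (H n)" for n
    unfolding H_def polytope_def by blast
  have sH: "s k \<in> H n" if "k \<le> n" for k n
    unfolding H_def using that by (intro hull_inc) auto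
  have "\<forall>\<^sub>F n in sequentially. c / 2 < (u \<bullet> s n) / n"
    using along c by (intro order_tendstoD) auto
  moreover have "\<forall>\<^sub>F n in sequentially. \<forall>k\<le>n. \<bar>perp u \<bullet> s k\<bar> \<le> d * n"
    using across s0 d by (intro sublinear_running_max) auto
  ultimately show "\<forall>\<^sub>F n in sequentially. dist (polygon_perimeter (H n) / diameter (H n)) 2 < e"
    using eventually_gt_at_top[of 0]
  proof eventually_elim
    case (elim n)
    let ?D = "diameter (H n)" and ?L = "polygon_perimeter (H n)"
    have "c / 2 * n < u \<bullet> s n" using elim by (simp add: field_simps)
    also have "\<dots> \<le> dist (s n) (s 0)"
      using norm_cauchy_schwarz[of u "s n"] u s0 by simp
    also have "\<dots> \<le> ?D"
      using poly[of n] sH by (intro diameter_bounded_bound polytope_imp_bounded) auto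
    finally have D: "c / 2 * n < ?D" .
    moreover have "0 \<le> c / 2 * n" using c by simp
    ultimately have D0: "0 < ?D" by linarith
    have "convex {x. \<bar>perp u \<bullet> x\<bar> \<le> d * n}"
    proof -
      have "{x. \<bar>perp u \<bullet> x\<bar> \<le> d * n} = {x. perp u \<bullet> x \<le> d * n} \<inter> {x. perp u \<bullet> x \<ge> - (d * n)}"
        by auto
      then show ?thesis
        by (simp add: convex_Int convex_halfspace_le convex_halfspace_ge)
    qed
    then have "H n \<subseteq> {x. \<bar>perp u \<bullet> x\<bar> \<le> d * n}"
      unfolding H_def using elim by (intro hull_minimal) auto
    then have "\<bar>perp u \<bullet> x\<bar> \<le> d * n" if "x \<in> H n" for x
      using that by blast
    then have "(\<bullet>) (perp u) ` H n \<subseteq> {- (d * n)..d * n}"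
      by (auto simp: abs_le_iff minus_le_iff)
    moreover obtain a b where ab: "(\<bullet>) (perp u) ` H n = {a..b}"
      using inner_image_interval[OF polytope_imp_compact convex_connected[OF polytope_imp_convex], OF poly poly]
      by blast
    ultimately have "{a..b} \<subseteq> {- (d * n)..d * n}" by simp
    then have width: "measure lborel ((\<bullet>) (perp u) ` H n) \<le> 2 * d * n"
      unfolding ab using d by (cases "a \<le> b") auto
    have "?L \<le> 2 * ?D + 2 * (2 * d * n)"
      using perimeter_le_diameter_plus_width[OF poly[of n] _ u] width sH by fastforce
    also have "\<dots> = 2 * ?D + e * (c / 2 * n)" by (simp add: d_def)
    also have "\<dots> < 2 * ?D + e * ?D"
      using mult_strict_left_mono[OF D e] by simp
    finally have "?L / ?D < 2 + e"
      using D0 by (simp add: field_simps)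
    moreover have "2 \<le> ?L / ?D"
      using two_diameter_le_perimeter[OF poly[of n]] D0 by (simp add: field_simps)
    ultimately show ?case by (simp add: dist_real_def)
  qed
qed

section \<open>The convex hull of a planar random walk with drift\<close>

theorem corollary1p4:
  fixes M :: "'a measure" and Z :: "'a \<Rightarrow> real^2" and X :: "nat \<Rightarrow> 'a \<Rightarrow> real^2"
  assumes "prob_space M"
    and "Z \<in> borel_measurable M"
    and "prob_space.indep_vars M (\<lambda>_. borel) X {1..}"
    and "\<And>n. n \<ge> 1 \<Longrightarrow> distr M borel (X n) = distr M borel Z"
    and "integrable M (\<lambda>\<omega>. norm (Z \<omega>))"
    and "prob_space.expectation M Z \<noteq> 0"
  shows "AE \<omega> in M.
    (\<lambda>n. polygon_perimeter (walk_hull X n \<omega>) / diameter (walk_hull X n \<omega>)) \<longlonglongrightarrow> 2"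
proof -
  interpret prob_space M by fact
  note [measurable] = assms(2)
  have indep: "indep_vars (\<lambda>_. borel) X {1..}" by fact
  have [measurable]: "X n \<in> borel_measurable M" if "n \<ge> 1" for n
    using indep that by (auto simp: indep_vars_def)
  have intZ: "integrable M Z"
    using assms(5) by (simp add: integrable_norm_iff)
  let ?mu = "expectation Z"
  define u where "u = ?mu /\<^sub>R norm ?mu"
  have u: "norm u = 1" "u \<bullet> ?mu = norm ?mu"
    using assms(6) by (auto simp: u_def simp flip: power2_norm_eq_inner) (simp add: power2_eq_square)
  have mu: "?mu = norm ?mu *\<^sub>R u" using assms(6) by (simp add: u_def)
  \<comment> \<open>The indices start at 1, so the steps are shifted to start at 0.\<close>
  have slln: "AE \<omega> in M. (\<lambda>n. (w \<bullet> walk X n \<omega>) / n) \<longlonglongrightarrow> w \<bullet> ?mu" for w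
  proof -
    have "AE \<omega> in M. (\<lambda>n. (\<Sum>k<n. w \<bullet> X (Suc k) \<omega>) / n) \<longlonglongrightarrow> expectation (\<lambda>\<omega>. w \<bullet> Z \<omega>)"
    proof (rule strong_law_of_large_numbers)
      have "indep_vars (\<lambda>_. borel) (\<lambda>k. X (Suc k)) UNIV"
      proof -
        have "indep_vars (\<lambda>k. \<Pi>\<^sub>M i\<in>{Suc k}. borel) (\<lambda>k \<omega>. restrict (\<lambda>i. X i \<omega>) {Suc k}) UNIV"
          by (rule indep_vars_restrict[OF indep]) (auto simp: disjoint_family_on_def)
        then have "indep_vars (\<lambda>_. borel) (\<lambda>k \<omega>. restrict (\<lambda>i. X i \<omega>) {Suc k} (Suc k)) UNIV"
          by (rule indep_vars_compose2[where Y = "\<lambda>k f. f (Suc k)"]) auto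
        then show ?thesis by simp
      qed
      then show "indep_vars (\<lambda>_. borel) (\<lambda>k \<omega>. w \<bullet> X (Suc k) \<omega>) UNIV"
        by (rule indep_vars_compose2) auto
      show "distr M borel (\<lambda>\<omega>. w \<bullet> X (Suc n) \<omega>) = distr M borel (\<lambda>\<omega>. w \<bullet> Z \<omega>)" for n
        by (rule distr_compose_cong[of _ borel _ _ "(\<bullet>) w"]) (use assms(4) in auto)
      show "integrable M (\<lambda>\<omega>. w \<bullet> Z \<omega>)" using intZ by simp
    qed
    then show ?thesis
      using intZ by (simp add: walk_def inner_sum_right sum.atLeast1_atMost_eq)
  qed
  from slln[of u] slln[of "perp u"] show ?thesis
  proof eventually_elim
    case (elim \<omega>)
    have "perp u \<bullet> ?mu = 0"
      by (subst mu) (simp add: inner_commute[of "perp u"])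
    then show ?case
      unfolding walk_hull_def using elim u assms(6)
      by (intro perimeter_over_diameter_tendsto[of u _ "norm ?mu"]) (auto simp: walk_def)
  qed
qed

end
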